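(* Let $g \in M^1(\mathbb{R})$ and let $\{z_1,\ldots,z_M\} \subset [0,1)^2$ be distinct zeros of its Zak transform, i.e., $\mathcal{Z}g(z_m)=0$ for $m=1,\ldots,M$. Then the multi-window Gabor system $\bigcup_{m=1}^M \mathcal{G}(\pi(z_m)g,\mathbb{Z}^2)$ is not a frame for $L^2(\mathbb{R})$. Equivalently, the Gabor system $\mathcal{G}\left(g, \bigcup_{m=1}^M (\mathbb{Z}^2+z_m)\right)$ is not a frame for $L^2(\mathbb{R})$.
   Context: For $z=(x,\omega)\in\mathbb{R}^2$ the time-frequency shift is $\pi(z)=M_\omega T_x$, where $T_xf(t)=f(t-x)$ and $M_\omega f(t)=e^{2\pi i\omega t}f(t)$. For $\Gamma\subset\mathbb{R}^2$, the Gabor system is $\mathcal{G}(g,\Gamma)=\{\pi(\gamma)g \mid \gamma\in\Gamma\}$. It is a frame for $L^2(\mathbb{R})$ if there are constants $0<A\le B<\infty$ with $A\|f\|_{L^2}^2\le\sum_{\gamma\in\Gamma}|\langle f,\pi(\gamma)g\rangle|^2\le B\|f\|_{L^2}^2$ for all $f\in L^2(\mathbb{R})$. A multi-window system $\bigcup_{m=1}^M\mathcal{G}(g_m,\Gamma)$ is a frame if the same holds with the middle term replaced by $\sum_{m=1}^M\sum_{\gamma\in\Gamma}|\langle f,\pi(\gamma)g_m\rangle|^2$. $M^1(\mathbb{R})$ is the modulation space (Feichtinger algebra) of all $f\in L^2(\mathbb{R})$ such that $z\mapsto\langle f,\pi(z)\phi\rangle$ is in $L^1(\mathbb{R}^2)$,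 where $\phi(t)=e^{-\pi t^2}$; its elements are identified with their continuous representatives. The Zak transform of $f\in M^1(\mathbb{R})$ is $\mathcal{Z}f(x,\omega)=\sum_{k\in\mathbb{Z}}f(k-x)e^{2\pi ik\omega}$ (a continuous function on $\mathbb{R}^2$). *)

theory Defs
  imports "HOL-Analysis.Analysis"
begin

text \<open>
  Elements of \<open>L\<^sup>2(\<real>)\<close> are represented by functions rather than by classes modulo
  null sets; every class has a Borel measurable representative.
\<close>

definition L2_space :: "(real \<Rightarrow> complex) set" where
  "L2_space = {f \<in> borel_measurable lborel. integrable lborel (\<lambda>t. (cmod (f t))\<^sup>2)}"

definition L2_inner :: "(real \<Rightarrow> complex) \<Rightarrow> (real \<Rightarrow> complex) \<Rightarrow> complex" where
  "L2_inner f h = (LINT t|lborel. f t * cnj (h t))"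

definition L2_norm :: "(real \<Rightarrow> complex) \<Rightarrow> real" where
  "L2_norm f = sqrt (LINT t|lborel. (cmod (f t))\<^sup>2)"

definition translation :: "real \<Rightarrow> (real \<Rightarrow> complex) \<Rightarrow> real \<Rightarrow> complex" where
  "translation x f t = f (t - x)"

definition modulation :: "real \<Rightarrow> (real \<Rightarrow> complex) \<Rightarrow> real \<Rightarrow> complex" where
  "modulation \<omega> f t = exp (2 * pi * \<i> * \<omega> * t) * f t"

definition tf_shift :: "real \<times> real \<Rightarrow> (real \<Rightarrow> complex) \<Rightarrow> real \<Rightarrow> complex" where
  "tf_shift z f = modulation (snd z) (translation (fst z) f)"

definition gaussian :: "real \<Rightarrow> complex" where
  "gaussian t = of_real (exp (- pi * t\<^sup>2))"

text \<open>
  The Feichtinger algebra \<open>M\<^sup>1(\<real>)\<close>. Each class in it contains exactly one continuous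
  function, and it is this function that represents the class here.
\<close>

definition M1_space :: "(real \<Rightarrow> complex) set" where
  "M1_space = {f \<in> L2_space. continuous_on UNIV f \<and>
     integrable (lborel :: (real \<times> real) measure) (\<lambda>z. L2_inner f (tf_shift z gaussian))}"

text \<open>For \<open>f\<close> in \<open>M1_space\<close> the series converges absolutely, so \<open>infsum\<close> is its actual sum.\<close>

definition zak :: "(real \<Rightarrow> complex) \<Rightarrow> real \<times> real \<Rightarrow> complex" where
  "zak f = (\<lambda>(x, \<omega>). \<Sum>\<^sub>\<infinity>k\<in>(UNIV :: int set). f (of_int k - x) * exp (2 * pi * \<i> * k * \<omega>))"

text \<open>
  The sums over the index set \<open>\<Gamma>\<close> are taken in \<open>ennreal\<close>, where they always exist; the upper
  frame bound then forces them to be finite.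
\<close>

definition gabor_frame :: "(real \<Rightarrow> complex) \<Rightarrow> (real \<times> real) set \<Rightarrow> bool" where
  "gabor_frame g \<Gamma> \<longleftrightarrow>
     (\<exists>A B :: real. 0 < A \<and> A \<le> B \<and>
       (\<forall>f\<in>L2_space.
          ennreal (A * (L2_norm f)\<^sup>2)
            \<le> (\<Sum>\<^sub>\<infinity>\<gamma>\<in>\<Gamma>. ennreal ((cmod (L2_inner f (tf_shift \<gamma> g)))\<^sup>2)) \<and>
          (\<Sum>\<^sub>\<infinity>\<gamma>\<in>\<Gamma>. ennreal ((cmod (L2_inner f (tf_shift \<gamma> g)))\<^sup>2))
            \<le> ennreal (B * (L2_norm f)\<^sup>2)))"

definition multi_window_gabor_frame ::
    "nat \<Rightarrow> (nat \<Rightarrow> real \<Rightarrow> complex) \<Rightarrow> (real \<times> real) set \<Rightarrow> bool" where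
  "multi_window_gabor_frame M g \<Gamma> \<longleftrightarrow>
     (\<exists>A B :: real. 0 < A \<and> A \<le> B \<and>
       (\<forall>f\<in>L2_space.
          ennreal (A * (L2_norm f)\<^sup>2)
            \<le> (\<Sum>m=1..M. \<Sum>\<^sub>\<infinity>\<gamma>\<in>\<Gamma>. ennreal ((cmod (L2_inner f (tf_shift \<gamma> (g m))))\<^sup>2)) \<and>
          (\<Sum>m=1..M. \<Sum>\<^sub>\<infinity>\<gamma>\<in>\<Gamma>. ennreal ((cmod (L2_inner f (tf_shift \<gamma> (g m))))\<^sup>2))
            \<le> ennreal (B * (L2_norm f)\<^sup>2)))"

end

theory Submission
  imports Defs "HOL-Probability.Characteristic_Functions" "HOL-Real_Asymp.Real_Asymp"
begin

text \<open>
  The lattice shifts of \<open>\<pi>(z)g\<close> are diagonalised by the Zak transform, and \<open>\<pi>(z)g\<close> has a Zak transform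
  that vanishes at the origin as soon as \<open>g\<close> has one that vanishes at \<open>z\<close>. Hence all windows
  \<open>\<pi>(z\<^sub>m)g\<close> have a common zero of their (continuous) Zak transforms, and an \<open>f\<close> whose Zak transform
  is concentrated near the origin violates the lower frame bound. The unions of \<open>N\<close> intervals of length \<open>1/N\<close>
  ending at consecutive integers are such \<open>f\<close>, and for them the coefficients can be estimated without
  the Zak transform: Bessel's inequality on \<open>[0,1]\<close> handles the modulations, and the sum over
  translations is one over windows of length \<open>N\<close> of an absolutely summable sequence with total close
  to \<open>0\<close>. The uniform summability needed for this is the inclusion of \<open>M\<^sup>1\<close> in the Wiener amalgam space.
\<close>

subsection \<open>Two inequalities for sequences and Fourier coefficients\<close>

text \<open>
  A window \<open>{-j..<N-j}\<close> contains \<open>{-K..K}\<close> or is disjoint from it, except for \<open>4K\<close> values of \<open>j\<close>;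
  in both of these cases the sum over it is small.
\<close>

lemma window_sums:
  fixes H :: "int \<Rightarrow> complex" and \<beta> :: "int \<Rightarrow> real" and K N :: nat
  assumes H: "\<And>n. cmod (H n) \<le> \<beta> n" and \<beta>: "\<beta> summable_on UNIV"
    and tail: "infsum \<beta> (- {- int K..int K}) \<le> \<eta>"
    and centre: "cmod (\<Sum>n\<in>{- int K..int K}. H n) \<le> 2 * \<eta>"
    and J: "finite J"
  shows "(\<Sum>j\<in>J. (cmod (\<Sum>k<N. H (int k - j)))\<^sup>2)
           \<le> 3 * \<eta> * (real N * infsum \<beta> UNIV) + 4 * real K * (infsum \<beta> UNIV)\<^sup>2"
proof -
  define C where "C = infsum \<beta> UNIV"
  define S where "S j = (\<Sum>k<N. H (int k - j))" for j
  define W where "W j = {- j..<int N - j}" for j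
  \<comment> \<open>\<open>j \<in> E\<close> says that \<open>- j\<close> or
    \<open>int N - j\<close> lies in \<open>{- int K<..int K}\<close>: only then can the window cut
    the central block in two.\<close>
  define E where "E = {- int K..<int K} \<union> {int N - int K..<int N + int K}"
  have \<beta>0: "\<beta> n \<ge> 0" for n
    using H[of n] norm_ge_zero order_trans by blast
  have \<eta>0: "\<eta> \<ge> 0"
    using tail infsum_nonneg[of "- {- int K..int K}" \<beta>] \<beta>0 by auto
  have fin_le: "sum \<beta> F \<le> C" if "finite F" for F
    unfolding C_def using \<beta> that \<beta>0 by (intro finite_sum_le_infsum) auto
  have tail_le: "sum \<beta> F \<le> \<eta>" if "finite F" "F \<inter> {- int K..int K} = {}" for F
  proof -
    have "sum \<beta> F \<le> infsum \<beta> (- {- int K..int K})"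
      using that \<beta>0 \<beta> by (intro finite_sum_le_infsum) (auto intro: summable_on_subset_banach)
    then show ?thesis using tail by simp
  qed
  have SW: "S j = sum H (W j)" for j
    unfolding S_def W_def
    by (rule sum.reindex_bij_witness[where i = "\<lambda>n. nat (n + j)" and j = "\<lambda>k. int k - j"]) auto
  have normsum: "cmod (sum H F) \<le> sum \<beta> F" for F
    by (rule order_trans[OF norm_sum]) (intro sum_mono H)
  have S_C: "cmod (S j) \<le> C" for j
    unfolding SW using normsum[of "W j"] fin_le[of "W j"] by (simp add: W_def)
  have S_small: "cmod (S j) \<le> 3 * \<eta>" if jE: "j \<notin> E" for j
  proof -
    consider "W j \<inter> {- int K..int K} = {}" | "{- int K..int K} \<subseteq> W j"
    proof (cases "W j \<inter> {- int K..int K} = {}")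
      case False
      then obtain n where n: "- j \<le> n" "n < int N - j" "- int K \<le> n" "n \<le> int K"
        by (auto simp: W_def)
      have "int K \<le> j \<and> j < int N - int K"
        using jE n unfolding E_def by auto
      then have "{- int K..int K} \<subseteq> W j" by (auto simp: W_def)
      then show ?thesis using that by blast
    qed (use that in blast)
    then show ?thesis
    proof cases
      case 1
      then have "cmod (S j) \<le> \<eta>"
        unfolding SW using normsum[of "W j"] tail_le[of "W j"] by (simp add: W_def)
      then show ?thesis using \<eta>0 by simp
    next
      case 2
      have "S j = sum H (W j - {- int K..int K}) + sum H {- int K..int K}"
        unfolding SW by (rule sum.subset_diff[OF 2]) (simp add: W_def)
      also have "cmod \<dots> \<le> cmod (sum H (W j - {- int K..int K})) + cmod (sum H {- int K..int K})"
        by (rule norm_triangle_ineq)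
      also have "\<dots> \<le> \<eta> + 2 * \<eta>"
      proof (intro add_mono centre)
        have "sum \<beta> (W j - {- int K..int K}) \<le> \<eta>"
          by (rule tail_le) (auto simp: W_def)
        then show "cmod (sum H (W j - {- int K..int K})) \<le> \<eta>"
          by (rule order_trans[OF normsum])
      qed
      finally show ?thesis by simp
    qed
  qed
  \<comment> \<open>Outside \<open>E\<close> only one of the two factors \<open>cmod (S j)\<close>
    is replaced by 3 \<eta>. The other is kept for the sum over \<open>J\<close>, whose size is not
    controlled.\<close>
  have pt: "(cmod (S j))\<^sup>2 \<le> (if j \<in> E then C\<^sup>2 else 0) + 3 * \<eta> * cmod (S j)" for j
  proof (cases "j \<in> E")
    case True
    then show ?thesis using power_mono[OF S_C[of j], of 2] \<eta>0 by (simp add: add_increasing2)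
  next
    case False
    then show ?thesis using mult_right_mono[OF S_small[OF False], of "cmod (S j)"]
      by (simp add: power2_eq_square)
  qed
  have card_E: "card (J \<inter> E) \<le> 4 * K"
  proof -
    have "card (J \<inter> E) \<le> card E" by (intro card_mono) (auto simp: E_def)
    also have "\<dots> \<le> card {- int K..<int K} + card {int N - int K..<int N + int K}"
      unfolding E_def by (rule card_Un_le)
    finally show ?thesis by simp
  qed
  \<comment> \<open>After swapping the sums, each of the N values of \<open>k\<close> meets distinct
    entries of \<open>\<beta>\<close>, so the bound grows like N and is independent of
    \<open>J\<close>.\<close>
  have "(\<Sum>j\<in>J. cmod (S j)) \<le> (\<Sum>j\<in>J. \<Sum>k<N. \<beta> (int k - j))"
    unfolding S_def by (intro sum_mono order_trans[OF norm_sum] H)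
  also have "\<dots> = (\<Sum>k<N. \<Sum>j\<in>J. \<beta> (int k - j))" by (rule sum.swap)
  also have "\<dots> \<le> (\<Sum>k<N. C)"
  proof (intro sum_mono)
    fix k
    have "(\<Sum>j\<in>J. \<beta> (int k - j)) = sum \<beta> ((\<lambda>j. int k - j) ` J)"
      by (subst sum.reindex) (auto simp: inj_on_def)
    also have "\<dots> \<le> C" using J by (intro fin_le) auto
    finally show "(\<Sum>j\<in>J. \<beta> (int k - j)) \<le> C" .
  qed
  finally have l1: "(\<Sum>j\<in>J. cmod (S j)) \<le> real N * C" by simp
  have "(\<Sum>j\<in>J. (cmod (S j))\<^sup>2) \<le> (\<Sum>j\<in>J. (if j \<in> E then C\<^sup>2 else 0) + 3 * \<eta> * cmod (S j))"
    by (intro sum_mono pt)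
  also have "\<dots> = real (card (J \<inter> E)) * C\<^sup>2 + 3 * \<eta> * (\<Sum>j\<in>J. cmod (S j))"
    using J by (simp add: sum.distrib sum_distrib_left sum.If_cases Int_def)
  also have "\<dots> \<le> (4 * real K) * C\<^sup>2 + 3 * \<eta> * (real N * C)"
    using card_E l1 \<eta>0 by (intro add_mono mult_right_mono mult_left_mono) (auto simp flip: of_nat_mult)
  finally show ?thesis by (simp add: S_def C_def)
qed

section \<open>Bessel's inequality for the exponentials on the unit interval\<close>

lemma integral_cis_int:
  "(LINT x|lborel. indicator {0..1} x *\<^sub>R cis (2 * pi * of_int l * x)) = (if l = 0 then 1 else 0)"
proof (cases "l = 0")
  case False
  define c where "c = 2 * pi * of_int l"
  have c: "c \<noteq> 0" using False by (simp add: c_def)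
  have "(LINT x|lborel. indicator {0..1} x *\<^sub>R cis (c * x)) = cis (c * 1) / (\<i> * c) - cis (c * 0) / (\<i> * c)"
  proof (rule integral_FTC_atLeastAtMost)
    fix x :: real
    show "((\<lambda>x. cis (c * x) / (\<i> * c)) has_vector_derivative cis (c * x)) (at x within {0..1})"
    proof -
      have "((\<lambda>w. exp (\<i> * c * w) / (\<i> * c)) has_field_derivative exp (\<i> * c * of_real x)) (at (of_real x))"
        using c by (auto intro!: derivative_eq_intros)
      then show ?thesis
        unfolding cis_conv_exp by (auto dest!: has_vector_derivative_real_field simp: mult.assoc)
    qed
  qed (auto intro!: continuous_intros)
  moreover have "cis c = 1" unfolding c_def using cis_multiple_2pi[of "of_int l"] by simp
  ultimately show ?thesis using False by (simp add: c_def)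
qed simp

text \<open>The integral of |\<Phi> - T|^2 is nonnegative when T is the projection of
  \<open>\<Phi>\<close> to the span of the exponentials with frequencies in \<open>L\<close>, cut
  off to [0, 1]. Boundedness and bounded support of \<open>\<Phi>\<close> give the integrability of
  the terms that contain it.\<close>

lemma bessel_unit_interval:
  fixes \<Phi> :: "real \<Rightarrow> complex"
  assumes [measurable]: "\<Phi> \<in> borel_measurable borel" and bnd: "\<And>x. cmod (\<Phi> x) \<le> C"
    and supp: "\<And>x. x \<notin> {0..1} \<Longrightarrow> \<Phi> x = 0" and L: "finite L"
  shows "(\<Sum>l\<in>L. (cmod (LINT x|lborel. \<Phi> x * cis (- (2 * pi * of_int l * x))))\<^sup>2)
           \<le> (LINT x|lborel. (cmod (\<Phi> x))\<^sup>2)"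
proof -
  define I :: "real \<Rightarrow> complex" where "I = indicator {0..1}"
  define e where "e l x = cis (2 * pi * of_int l * x)" for l :: int and x
  have e_cnj: "cnj (e l x) = cis (- (2 * pi * of_int l * x))" for l x
    by (simp add: e_def cis_cnj)
  have [measurable]: "cis \<in> borel_measurable borel"
    by (intro borel_measurable_continuous_onI continuous_intros)
  have [measurable]: "e l \<in> borel_measurable borel" for l
    unfolding e_def by (intro borel_measurable_continuous_onI continuous_intros)
  have [measurable]: "cnj \<in> borel_measurable borel"
    by (intro borel_measurable_continuous_onI continuous_intros)
  have norm_e: "cmod (e l x) = 1" for l x by (simp add: e_def)
  have [measurable]: "I \<in> borel_measurable borel" by (simp add: I_def)
  have int: "integrable lborel h" if [measurable]: "h \<in> borel_measurable borel"
    and "\<And>x. cmod (h x) \<le> D * indicator {0..1} x" for h :: "real \<Rightarrow> complex" and D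
    by (rule Bochner_Integration.integrable_bound[where f = "\<lambda>x. D * indicator {0..1} x"])
       (use that(2) in \<open>auto intro!: AE_I2 order_trans[OF _ abs_ge_self]\<close>)
  have int\<Phi>e: "integrable lborel (\<lambda>x. \<Phi> x * cnj (e l x))" for l
    by (rule int[where D = C]) (measurable, use bnd supp in \<open>auto simp: norm_mult norm_e indicator_def\<close>)
  have int\<Phi>2: "integrable lborel (\<lambda>x. \<Phi> x * cnj (\<Phi> x))"
  proof (rule int[where D = "C * C"])
    show "cmod (\<Phi> x * cnj (\<Phi> x)) \<le> C * C * indicator {0..1} x" for x
    proof (cases "x \<in> {0..1}")
      case True
      then show ?thesis
        using mult_mono[OF bnd[of x] bnd[of x]] order_trans[OF norm_ge_zero bnd[of x]]
        by (simp add: norm_mult)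
    qed (simp add: supp)
  qed measurable
  have inte: "integrable lborel (\<lambda>x. I x * (e l x * cnj (e m x)))" for l m
    by (rule int[where D = 1]) (measurable, auto simp: norm_mult indicator_def norm_e I_def)
  define c where "c l = (LINT x|lborel. \<Phi> x * cnj (e l x))" for l
  define T where "T x = I x * (\<Sum>l\<in>L. c l * e l x)" for x
  have ortho: "(LINT x|lborel. I x * (e l x * cnj (e m x))) = (if l = m then 1 else 0)" for l m
  proof -
    have "(LINT x|lborel. I x * (e l x * cnj (e m x)))
        = (LINT x|lborel. indicator {0..1} x *\<^sub>R cis (2 * pi * of_int (l - m) * x))"
      by (intro Bochner_Integration.integral_cong)
         (auto simp: I_def e_def cis_cnj cis_mult indicator_def algebra_simps)
    then show ?thesis using integral_cis_int[of "l - m"] by simp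
  qed
  have c_cnj: "(LINT x|lborel. cnj (\<Phi> x) * e l x) = cnj (c l)" for l
    unfolding c_def by (simp flip: Bochner_Integration.integral_cnj)
  have int\<Phi>e': "integrable lborel (\<lambda>x. cnj (\<Phi> x) * e l x)" for l
    by (rule int[where D = C]) (measurable, use bnd supp in \<open>auto simp: norm_mult norm_e indicator_def\<close>)
  have expand: "(\<Phi> x - T x) * cnj (\<Phi> x - T x) = \<Phi> x * cnj (\<Phi> x)
      - (\<Sum>l\<in>L. c l * (cnj (\<Phi> x) * e l x)) - (\<Sum>l\<in>L. cnj (c l) * (\<Phi> x * cnj (e l x)))
      + (\<Sum>l\<in>L. \<Sum>m\<in>L. c l * cnj (c m) * (I x * (e l x * cnj (e m x))))" for x
  proof (cases "x \<in> {0..1}")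
    case True
    have "(\<Sum>l\<in>L. \<Sum>m\<in>L. c l * cnj (c m) * (I x * (e l x * cnj (e m x))))
       = (\<Sum>l\<in>L. c l * e l x) * cnj (\<Sum>l\<in>L. c l * e l x)"
      using True by (simp add: I_def sum_product algebra_simps)
    then show ?thesis using True
      by (simp add: T_def I_def algebra_simps sum_distrib_left)
  next
    case False
    then show ?thesis by (simp add: T_def I_def supp)
  qed
  \<comment> \<open>The two mixed sums each subtract the square sum of the coefficients; by
    orthonormality the double sum adds it back once.\<close>
  have "(LINT x|lborel. (\<Phi> x - T x) * cnj (\<Phi> x - T x)) = (LINT x|lborel. \<Phi> x * cnj (\<Phi> x))
      - (\<Sum>l\<in>L. c l * cnj (c l)) - (\<Sum>l\<in>L. cnj (c l) * c l)
      + (\<Sum>l\<in>L. \<Sum>m\<in>L. c l * cnj (c m) * (if l = m then 1 else 0))"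
    unfolding expand
    by (simp add: int\<Phi>2 int\<Phi>e int\<Phi>e' inte c_cnj ortho flip: c_def)
  also have "(\<Sum>l\<in>L. \<Sum>m\<in>L. c l * cnj (c m) * (if l = m then 1 else 0)) = (\<Sum>l\<in>L. c l * cnj (c l))"
    using L by (simp add: if_distrib cong: if_cong)
  finally have "(LINT x|lborel. (\<Phi> x - T x) * cnj (\<Phi> x - T x))
      = (LINT x|lborel. \<Phi> x * cnj (\<Phi> x)) - (\<Sum>l\<in>L. c l * cnj (c l))"
    by (simp add: mult.commute)
  moreover have sq: "(LINT x|lborel. w x * cnj (w x)) = complex_of_real (LINT x|lborel. (cmod (w x))\<^sup>2)" for w
    unfolding complex_norm_square[symmetric] by (rule integral_complex_of_real)
  moreover have "(\<Sum>l\<in>L. c l * cnj (c l)) = complex_of_real (\<Sum>l\<in>L. (cmod (c l))\<^sup>2)"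
    unfolding complex_norm_square[symmetric] by simp
  ultimately have "complex_of_real (LINT x|lborel. (cmod (\<Phi> x - T x))\<^sup>2)
      = of_real ((LINT x|lborel. (cmod (\<Phi> x))\<^sup>2) - (\<Sum>l\<in>L. (cmod (c l))\<^sup>2))"
    by (simp only: of_real_diff sq[of \<Phi>] sq[of "\<lambda>x. \<Phi> x - T x"])
  then have "(LINT x|lborel. (cmod (\<Phi> x - T x))\<^sup>2)
      = (LINT x|lborel. (cmod (\<Phi> x))\<^sup>2) - (\<Sum>l\<in>L. (cmod (c l))\<^sup>2)"
    using of_real_eq_iff by blast
  moreover have "(LINT x|lborel. (cmod (\<Phi> x - T x))\<^sup>2) \<ge> 0" by simp
  ultimately show ?thesis by (simp add: c_def e_cnj)
qed

subsection \<open>A weak form of Fourier inversion\<close>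

text \<open>After the substitution \<omega> = m x this is the characteristic function of the
  standard normal law at 2 pi m r; the factor \<open>m\<close> is the Jacobian.\<close>

lemma gaussian_fourier:
  fixes m r :: real
  assumes m: "m > 0"
  shows "(LINT \<omega>|lborel. cis (2 * pi * \<omega> * r) * of_real (std_normal_density (\<omega> / m)))
       = of_real (m * exp (- (2 * pi\<^sup>2 * (m * r)\<^sup>2)))"
proof -
  have "char std_normal_distribution (2 * pi * m * r)
      = (LINT x|lborel. std_normal_density x *\<^sub>R cis (2 * pi * m * r * x))"
    unfolding char_def by (subst integral_density) (auto simp: cis_conv_exp)
  also have "\<dots> = \<bar>1 / m\<bar> *\<^sub>R (LINT \<omega>|lborel. std_normal_density (0 + 1 / m * \<omega>)
      *\<^sub>R cis (2 * pi * m * r * (0 + 1 / m * \<omega>)))"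
    using m by (intro lborel_integral_real_affine) auto
  also have "\<dots> = (LINT \<omega>|lborel. cis (2 * pi * \<omega> * r) * of_real (std_normal_density (\<omega> / m))) / of_real m"
    using m by (simp add: scaleR_conv_of_real mult_ac)
  finally show ?thesis
    using m by (simp add: char_std_normal_distribution field_simps power2_eq_square)
qed

text \<open>A rescaled normal density. Its mass is not 1, which explains the constant sqrt (2 pi) in
  the approximate identity below.\<close>

lemma integral_exp_2_pi_sq:
  "(LINT w|lborel. exp (- (2 * pi\<^sup>2 * w\<^sup>2))) = 1 / sqrt (2 * pi)"
  "integrable lborel (\<lambda>w::real. exp (- (2 * pi\<^sup>2 * w\<^sup>2)))"
proof -
  have eq: "exp (- (2 * pi\<^sup>2 * w\<^sup>2)) = sqrt (2 * pi) * std_normal_density (0 + (2 * pi) * w)" for w :: real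
    by (simp add: std_normal_density_def power2_eq_square field_simps)
  have sq: "sqrt (2 * pi) / (2 * pi) = 1 / sqrt (2 * pi)"
    by (simp add: real_div_sqrt field_simps flip: power2_eq_square)
  have "(LINT x|lborel. std_normal_density x) = \<bar>2 * pi\<bar> *\<^sub>R (LINT w|lborel. std_normal_density (0 + (2 * pi) * w))"
    by (intro lborel_integral_real_affine) auto
  then have "(LINT w|lborel. std_normal_density (0 + (2 * pi) * w)) = 1 / (2 * pi)"
    using integral_std_normal_moment_even[of 0] by (simp add: field_simps)
  then show "(LINT w|lborel. exp (- (2 * pi\<^sup>2 * w\<^sup>2))) = 1 / sqrt (2 * pi)"
    unfolding eq integral_mult_right_zero using sq by simp
  have "integrable lborel std_normal_density"
    using integrable_std_normal_moment[of 0] by simp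
  then have "integrable lborel (\<lambda>w. std_normal_density (0 + (2 * pi) * w))"
    by (rule lborel_integrable_real_affine) simp
  then show "integrable lborel (\<lambda>w::real. exp (- (2 * pi\<^sup>2 * w\<^sup>2)))"
    unfolding eq by (rule integrable_mult_right)
qed

text \<open>\<open>F\<close> is known to be bounded only near \<open>t\<close>, so the integral is
  split at a distance \<open>d\<close>. Beyond \<open>d\<close> the kernels are uniformly bounded
  and a multiple of |F| dominates; within \<open>d\<close>, rescaling fixes the kernel and a
  Gaussian dominates.\<close>

lemma gaussian_approximate_identity:
  fixes F :: "real \<Rightarrow> complex"
  assumes F: "integrable lborel F" and cont: "isCont F t"
  shows "(\<lambda>n. LINT s|lborel. F s * of_real (real (Suc n) * exp (- (2 * pi\<^sup>2 * (real (Suc n) * (t - s))\<^sup>2))))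
      \<longlonglongrightarrow> F t / of_real (sqrt (2 * pi))"
proof -
  define k where "k n v = real (Suc n) * exp (- (2 * pi\<^sup>2 * (real (Suc n) * v)\<^sup>2))" for n v
  have [measurable]: "F \<in> borel_measurable borel" using F by auto
  have [measurable]: "k n \<in> borel_measurable borel" for n
    unfolding k_def by measurable
  have k0: "k n v \<ge> 0" for n v by (simp add: k_def)
  \<comment> \<open>Here continuity only has to give a local bound on \<open>F\<close>, so the
    tolerance 1 will do; the limit of the near part uses continuity again.\<close>
  obtain d where d: "d > 0" "\<And>s. dist s t < d \<Longrightarrow> dist (F s) (F t) < 1"
    using cont unfolding continuous_at_eps_delta by (metis zero_less_one)
  have F_near: "cmod (F s) \<le> cmod (F t) + 1" if "\<bar>s - t\<bar> < d" for s
    using d(2)[of s] that norm_triangle_ineq2[of "F s" "F t"] by (simp add: dist_norm)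
  \<comment> \<open>exp (- y) is at most 1 / y, and here y is quadratic in
    \<open>real (Suc n)\<close>, which absorbs the factor in front of the exponential.\<close>
  have k_le: "k n v \<le> 1 / (2 * pi\<^sup>2 * d\<^sup>2)" if "\<bar>v\<bar> \<ge> d" for n v
  proof -
    let ?m = "real (Suc n)"
    have y: "2 * pi\<^sup>2 * (?m * v)\<^sup>2 > 0" using that d by auto
    have "exp (- (2 * pi\<^sup>2 * (?m * v)\<^sup>2)) \<le> 1 / (2 * pi\<^sup>2 * (?m * v)\<^sup>2)"
      unfolding exp_minus inverse_eq_divide
      using order_trans[OF _ exp_ge_add_one_self, of "2 * pi\<^sup>2 * (?m * v)\<^sup>2" "2 * pi\<^sup>2 * (?m * v)\<^sup>2"] y
      by (intro divide_left_mono) (simp_all del: of_nat_Suc)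
    then have "k n v \<le> ?m * (1 / (2 * pi\<^sup>2 * (?m * v)\<^sup>2))"
      unfolding k_def by (intro mult_left_mono) auto
    also have "\<dots> = 1 / (?m * (2 * pi\<^sup>2 * v\<^sup>2))"
      by (simp add: power2_eq_square mult_ac del: of_nat_Suc)
    also have "\<dots> \<le> 1 / (1 * (2 * pi\<^sup>2 * d\<^sup>2))"
    proof -
      have "d\<^sup>2 \<le> v\<^sup>2" using that d by (metis abs_le_square_iff abs_of_pos)
      then have "1 * (2 * pi\<^sup>2 * d\<^sup>2) \<le> ?m * (2 * pi\<^sup>2 * v\<^sup>2)"
        by (intro mult_mono) auto
      moreover have "0 < 1 * (2 * pi\<^sup>2 * d\<^sup>2)" using d by simp
      ultimately show ?thesis by (intro divide_left_mono)
        (use d \<open>d\<^sup>2 \<le> v\<^sup>2\<close> in \<open>auto intro!: mult_pos_pos simp del: of_nat_Suc\<close>)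
    qed
    finally show ?thesis by simp
  qed
  define near where "near s = indicator {s. \<bar>s - t\<bar> < d} s *\<^sub>R F s" for s
  define far where "far s = indicator {s. \<bar>s - t\<bar> \<ge> d} s *\<^sub>R F s" for s
  have [measurable]: "near \<in> borel_measurable borel" "far \<in> borel_measurable borel"
    unfolding near_def far_def by measurable
  have far_bound: "cmod (far s * of_real (k n (t - s))) \<le> cmod (F s) * (1 / (2 * pi\<^sup>2 * d\<^sup>2))" for s n
  proof (cases "\<bar>s - t\<bar> \<ge> d")
    case True
    then have "cmod (F s) * k n (t - s) \<le> cmod (F s) * (1 / (2 * pi\<^sup>2 * d\<^sup>2))"
      by (intro mult_left_mono k_le) auto
    then show ?thesis using True k0[of n "t - s"]
      by (simp add: far_def norm_mult)
  qed (simp add: far_def)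
  have far_int: "integrable lborel (\<lambda>s. far s * of_real (k n (t - s)))" for n
    by (rule Bochner_Integration.integrable_bound[where f = "\<lambda>s. cmod (F s) * (1 / (2 * pi\<^sup>2 * d\<^sup>2))"])
       (use F far_bound in \<open>auto intro!: AE_I2 integrable_norm order_trans[OF _ abs_ge_self]\<close>)
  have far_lim: "(\<lambda>n. LINT s|lborel. far s * of_real (k n (t - s))) \<longlonglongrightarrow> (LINT s|(lborel :: real measure). (0 :: complex))"
  proof (rule Bochner_Integration.integral_dominated_convergence[where w = "\<lambda>s. cmod (F s) * (1 / (2 * pi\<^sup>2 * d\<^sup>2))"])
    show "AE s in lborel. (\<lambda>n. far s * of_real (k n (t - s))) \<longlonglongrightarrow> 0"
    proof (rule AE_I2)
      fix s
      show "(\<lambda>n. far s * of_real (k n (t - s))) \<longlonglongrightarrow> 0"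
      proof (cases "\<bar>s - t\<bar> \<ge> d")
        case True
        then have c: "2 * pi\<^sup>2 * (t - s)\<^sup>2 > 0" using d by auto
        have "(\<lambda>n. real (Suc n) * exp (- (c * (real (Suc n))\<^sup>2))) \<longlonglongrightarrow> 0" if "c > 0" for c :: real
          using that by real_asymp
        from this[OF c] have "(\<lambda>n. k n (t - s)) \<longlonglongrightarrow> 0"
          by (simp add: k_def power_mult_distrib mult_ac)
        then have "(\<lambda>n. far s * of_real (k n (t - s))) \<longlonglongrightarrow> far s * of_real 0"
          by (intro tendsto_intros)
        then show ?thesis by simp
      qed (simp add: far_def)
    qed
  qed (use F far_bound in \<open>auto intro!: AE_I2 integrable_norm\<close>)
  \<comment> \<open>The near part after the substitution s = t - w / (n + 1), whose Jacobian cancels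
    the factor in \<open>k n\<close>.\<close>
  define G where "G n w = near (t - w / real (Suc n)) * of_real (exp (- (2 * pi\<^sup>2 * w\<^sup>2)))" for n w
  have [measurable]: "G n \<in> borel_measurable borel" for n
    unfolding G_def by measurable
  have near_bound: "cmod (near s) \<le> cmod (F t) + 1" for s
    using F_near[of s] by (auto simp: near_def indicator_def)
  have near_int: "integrable lborel (\<lambda>s. near s * of_real (k n (t - s)))" for n
  proof -
    have near: "integrable lborel near"
      unfolding near_def using F by (intro integrable_mult_indicator) auto
    have "\<bar>k n v\<bar> \<le> real (Suc n)" for v
      using k0[of n v] by (simp add: k_def)
    then have le: "cmod (near s * of_real (k n (t - s))) \<le> norm (cmod (near s) * real (Suc n))" for s
      by (simp only: norm_mult norm_of_real abs_of_nat abs_norm_cancel real_norm_def abs_mult mult_left_mono norm_ge_zero)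
    show ?thesis
    proof (rule Bochner_Integration.integrable_bound[where f = "\<lambda>s. cmod (near s) * real (Suc n)"])
      show "integrable lborel (\<lambda>s. cmod (near s) * real (Suc n))"
        using near by (intro integrable_mult_left integrable_norm)
      show "AE s in lborel. cmod (near s * of_real (k n (t - s))) \<le> norm (cmod (near s) * real (Suc n))"
        by (intro AE_I2 le)
    qed measurable
  qed
  have sub: "(LINT s|lborel. near s * of_real (k n (t - s))) = (LINT w|lborel. G n w)" for n
  proof -
    let ?m = "real (Suc n)"
    have "(LINT s|lborel. near s * of_real (k n (t - s)))
       = \<bar>- (1 / ?m)\<bar> *\<^sub>R (LINT w|lborel. near (t + - (1 / ?m) * w) * of_real (k n (t - (t + - (1 / ?m) * w))))"
      by (intro lborel_integral_real_affine) auto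
    also have "\<dots> = (LINT w|lborel. \<bar>- (1 / ?m)\<bar> *\<^sub>R (near (t + - (1 / ?m) * w) * of_real (k n (t - (t + - (1 / ?m) * w)))))"
      by simp
    also have "\<dots> = (LINT w|lborel. G n w)"
      by (intro Bochner_Integration.integral_cong) (simp_all add: G_def k_def scaleR_conv_of_real del: of_nat_Suc)
    finally show ?thesis .
  qed
  have near_lim: "(\<lambda>n. LINT w|lborel. G n w) \<longlonglongrightarrow> (LINT w|lborel. F t * of_real (exp (- (2 * pi\<^sup>2 * w\<^sup>2))))"
  proof (rule Bochner_Integration.integral_dominated_convergence[where w = "\<lambda>w. (cmod (F t) + 1) * exp (- (2 * pi\<^sup>2 * w\<^sup>2))"])
    show "integrable lborel (\<lambda>w. (cmod (F t) + 1) * exp (- (2 * pi\<^sup>2 * w\<^sup>2)))"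
      using integral_exp_2_pi_sq(2) by (rule integrable_mult_right)
    show "AE w in lborel. (\<lambda>n. G n w) \<longlonglongrightarrow> F t * of_real (exp (- (2 * pi\<^sup>2 * w\<^sup>2)))"
    proof (rule AE_I2)
      fix w :: real
      \<comment> \<open>For fixed \<open>w\<close> the argument eventually enters the
        \<open>d\<close>-neighbourhood of \<open>t\<close>, where \<open>near\<close> agrees with
        \<open>F\<close>.\<close>
      have l: "(\<lambda>n. t - w / real (Suc n)) \<longlonglongrightarrow> t" by real_asymp
      then have "eventually (\<lambda>n. dist (t - w / real (Suc n)) t < d) sequentially"
        using d(1) by (rule tendstoD)
      then have ev: "eventually (\<lambda>n. F (t - w / real (Suc n)) = near (t - w / real (Suc n))) sequentially"
        by eventually_elim (simp add: near_def dist_real_def)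
      have "(\<lambda>n. F (t - w / real (Suc n))) \<longlonglongrightarrow> F t"
        using isCont_tendsto_compose[OF cont l] .
      then have "(\<lambda>n. near (t - w / real (Suc n))) \<longlonglongrightarrow> F t"
        using ev by (rule Lim_transform_eventually)
      then show "(\<lambda>n. G n w) \<longlonglongrightarrow> F t * of_real (exp (- (2 * pi\<^sup>2 * w\<^sup>2)))"
        unfolding G_def by (intro tendsto_intros)
    qed
    show "AE w in lborel. cmod (G n w) \<le> (cmod (F t) + 1) * exp (- (2 * pi\<^sup>2 * w\<^sup>2))" for n
      using near_bound by (auto simp: G_def norm_mult intro!: AE_I2 mult_right_mono)
  qed auto
  have "(LINT s|lborel. F s * of_real (k n (t - s))) 
      = (LINT w|lborel. G n w) + (LINT s|lborel. far s * of_real (k n (t - s)))" for n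
  proof -
    have "F s * of_real (k n (t - s)) = near s * of_real (k n (t - s)) + far s * of_real (k n (t - s))" for s
      by (auto simp: near_def far_def indicator_def)
    then show ?thesis using near_int far_int by (simp flip: sub)
  qed
  then have "(\<lambda>n. LINT s|lborel. F s * of_real (k n (t - s)))
      \<longlonglongrightarrow> (LINT w|lborel. F t * of_real (exp (- (2 * pi\<^sup>2 * w\<^sup>2)))) + (LINT s|(lborel :: real measure). (0 :: complex))"
    using tendsto_add[OF near_lim far_lim] by simp
  also have "(LINT w|lborel. F t * of_real (exp (- (2 * pi\<^sup>2 * w\<^sup>2)))) = F t / of_real (sqrt (2 * pi))"
    using integral_exp_2_pi_sq by (simp add: integral_complex_of_real)
  finally show ?thesis by (simp add: k_def)
qed

text \<open>
  Multiplying the Fourier transform by a dilated Gaussian before inverting it turns the inversion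
  integral into a convolution of \<open>F\<close> with an approximate identity.
\<close>

lemma norm_le_integral_fourier:
  fixes F :: "real \<Rightarrow> complex"
  assumes F: "integrable lborel F" and cont: "isCont F t"
    and int: "integrable lborel (\<lambda>\<omega>. LINT s|lborel. F s * cis (- (2 * pi * \<omega> * s)))"
  shows "cmod (F t) \<le> (LINT \<omega>|lborel. cmod (LINT s|lborel. F s * cis (- (2 * pi * \<omega> * s))))"
proof -
  define Fh where "Fh \<omega> = (LINT s|lborel. F s * cis (- (2 * pi * \<omega> * s)))" for \<omega>
  define B where "B = (LINT \<omega>|lborel. cmod (Fh \<omega>))"
  have [measurable]: "F \<in> borel_measurable borel" using F by auto
  have [measurable]: "cis \<in> borel_measurable borel"
    by (intro borel_measurable_continuous_onI continuous_intros)
  have [measurable]: "Fh \<in> borel_measurable borel" using int unfolding Fh_def by auto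
  have intn: "integrable lborel (\<lambda>\<omega>. std_normal_density (\<omega> / m))" if "m > 0" for m :: real
    using lborel_integrable_real_affine[OF integrable_std_normal_moment[of 0], of "1 / m" 0] that
    by simp
  \<comment> \<open>The constant is the maximum of the normal density that damps the transform. It
    equals the mass of the limiting kernel, so it cancels when m tends to infinity.\<close>
  have bound: "cmod (LINT s|lborel. F s * of_real (m * exp (- (2 * pi\<^sup>2 * (m * (t - s))\<^sup>2)))) \<le> B / sqrt (2 * pi)"
    if m: "m > 0" for m :: real
  proof -
    \<comment> \<open>The Gaussian factor makes \<open>P\<close> absolutely integrable in both
      variables jointly, as Fubini requires.\<close>
    define P where "P s \<omega> = F s * (cis (2 * pi * \<omega> * (t - s)) * of_real (std_normal_density (\<omega> / m)))" for s \<omega>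
    have [measurable]: "(\<lambda>(s, \<omega>). P s \<omega>) \<in> borel_measurable (lborel \<Otimes>\<^sub>M lborel)"
      unfolding P_def by measurable
    have P_int: "integrable (lborel \<Otimes>\<^sub>M lborel) (\<lambda>(s, \<omega>). P s \<omega>)"
    proof (rule lborel_pair.Fubini_integrable)
      show "integrable lborel (\<lambda>s. LINT \<omega>|lborel. cmod (case (s, \<omega>) of (s, \<omega>) \<Rightarrow> P s \<omega>))"
        using F by (auto simp: P_def norm_mult intro!: integrable_norm)
      show "AE s in lborel. integrable lborel (\<lambda>\<omega>. case (s, \<omega>) of (s, \<omega>) \<Rightarrow> P s \<omega>)"
      proof (rule AE_I2)
        fix s
        show "integrable lborel (\<lambda>\<omega>. case (s, \<omega>) of (s, \<omega>) \<Rightarrow> P s \<omega>)"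
          by (rule Bochner_Integration.integrable_bound[where f = "\<lambda>\<omega>. cmod (F s) * std_normal_density (\<omega> / m)"])
             (use intn[OF m] in \<open>auto simp: P_def norm_mult intro!: AE_I2\<close>)
      qed
    qed measurable
    have "(LINT s|lborel. F s * of_real (m * exp (- (2 * pi\<^sup>2 * (m * (t - s))\<^sup>2))))
        = (LINT s|lborel. LINT \<omega>|lborel. P s \<omega>)"
      unfolding P_def by (simp only: integral_mult_right_zero gaussian_fourier[OF m])
    also have "\<dots> = (LINT \<omega>|lborel. LINT s|lborel. P s \<omega>)"
      by (rule lborel_pair.Fubini_integral[symmetric]) (rule P_int)
    also have "\<dots> = (LINT \<omega>|lborel. cis (2 * pi * \<omega> * t) * of_real (std_normal_density (\<omega> / m)) * Fh \<omega>)"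
    proof (rule Bochner_Integration.integral_cong[OF refl])
      fix \<omega>
      have "P s \<omega> = cis (2 * pi * \<omega> * t) * of_real (std_normal_density (\<omega> / m)) * (F s * cis (- (2 * pi * \<omega> * s)))"
        for s
      proof -
        have "cis (2 * pi * \<omega> * (t - s)) = cis (2 * pi * \<omega> * t) * cis (- (2 * pi * \<omega> * s))"
          by (simp add: cis_mult algebra_simps)
        then show ?thesis by (simp add: P_def mult_ac)
      qed
      then show "(LINT s|lborel. P s \<omega>) = cis (2 * pi * \<omega> * t) * of_real (std_normal_density (\<omega> / m)) * Fh \<omega>"
        by (simp add: Fh_def)
    qed
    also have "cmod \<dots> \<le> (LINT \<omega>|lborel. cmod (Fh \<omega>) / sqrt (2 * pi))"
    proof (rule Bochner_Integration.integral_norm_bound_integral)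
      have le: "cmod (cis (2 * pi * \<omega> * t) * of_real (std_normal_density (\<omega> / m)) * Fh \<omega>) \<le> cmod (Fh \<omega>) / sqrt (2 * pi)"
        for \<omega>
      proof -
        have "std_normal_density (\<omega> / m) \<le> 1 / sqrt (2 * pi)"
          by (simp add: std_normal_density_def divide_right_mono)
        then have "cmod (Fh \<omega>) * std_normal_density (\<omega> / m) \<le> cmod (Fh \<omega>) * (1 / sqrt (2 * pi))"
          by (rule mult_left_mono) simp
        then show ?thesis by (simp add: norm_mult mult.commute)
      qed
      show "integrable lborel (\<lambda>\<omega>. cis (2 * pi * \<omega> * t) * of_real (std_normal_density (\<omega> / m)) * Fh \<omega>)"
        by (rule Bochner_Integration.integrable_bound[where f = "\<lambda>\<omega>. cmod (Fh \<omega>) / sqrt (2 * pi)"])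
           (use int le in \<open>auto simp flip: Fh_def intro!: AE_I2 integrable_norm\<close>)
      show "cmod (cis (2 * pi * \<omega> * t) * of_real (std_normal_density (\<omega> / m)) * Fh \<omega>) \<le> cmod (Fh \<omega>) / sqrt (2 * pi)" for \<omega>
        by (rule le)
    qed (use int in \<open>auto simp flip: Fh_def intro!: integrable_norm\<close>)
    finally show ?thesis by (simp add: B_def)
  qed
  have "cmod (F t / of_real (sqrt (2 * pi))) \<le> B / sqrt (2 * pi)"
    by (rule Lim_bounded[OF tendsto_norm[OF gaussian_approximate_identity[OF F cont]]])
       (use bound[of "real (Suc n)" for n] in auto)
  then have "cmod (F t) \<le> B"
    by (simp add: norm_divide divide_le_cancel)
  then show ?thesis by (simp add: B_def Fh_def)
qed

subsection \<open>The Feichtinger algebra is contained in the Wiener amalgam space\<close>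

lemma gaussian_L2: "gaussian \<in> borel_measurable borel" "integrable lborel (\<lambda>t. (cmod (gaussian (t - x)))\<^sup>2)"
proof -
  show "gaussian \<in> borel_measurable borel"
    unfolding gaussian_def by measurable
  have "integrable lborel std_normal_density"
    using integrable_std_normal_moment[of 0] by simp
  \<comment> \<open>The squared Gaussian is exp (- 2 pi (t - x)^2), so the normal density has to be
    scaled by 2 sqrt pi.\<close>
  then have "integrable lborel (\<lambda>t. std_normal_density (- (2 * sqrt pi * x) + (2 * sqrt pi) * t))"
    by (rule lborel_integrable_real_affine) simp
  then have "integrable lborel (\<lambda>t. sqrt (2 * pi) * std_normal_density (- (2 * sqrt pi * x) + (2 * sqrt pi) * t))"
    by (rule integrable_mult_right)
  also have "(\<lambda>t. sqrt (2 * pi) * std_normal_density (- (2 * sqrt pi * x) + (2 * sqrt pi) * t))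
      = (\<lambda>t. (cmod (gaussian (t - x)))\<^sup>2)"
  proof
    fix t
    have "(- (2 * sqrt pi * x) + (2 * sqrt pi) * t)\<^sup>2 = (2 * sqrt pi * (t - x))\<^sup>2"
      by (simp add: algebra_simps)
    then have "(- (2 * sqrt pi * x) + (2 * sqrt pi) * t)\<^sup>2 = 4 * pi * (t - x)\<^sup>2"
      by (simp add: power_mult_distrib flip: right_diff_distrib)
    then show "sqrt (2 * pi) * std_normal_density (- (2 * sqrt pi * x) + (2 * sqrt pi) * t) = (cmod (gaussian (t - x)))\<^sup>2"
      by (simp add: std_normal_density_def gaussian_def norm_exp_eq_Re flip: exp_of_nat_mult exp_of_real)
  qed
  finally show "integrable lborel (\<lambda>t. (cmod (gaussian (t - x)))\<^sup>2)" .
qed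

text \<open>
  \<open>V (x, \<cdot>)\<close> is the Fourier transform of \<open>t \<mapsto> g t * gaussian (t - x)\<close>, so its \<open>L\<^sup>1\<close>-norm bounds \<open>g\<close> on
  the unit neighbourhood of \<open>x\<close> up to a constant.
\<close>

lemma M1_space_wiener:
  assumes g: "g \<in> M1_space"
  obtains \<beta> :: "int \<Rightarrow> real"
  where "\<beta> summable_on UNIV" and "\<And>k t. t \<in> {of_int k..of_int k + 1} \<Longrightarrow> cmod (g t) \<le> \<beta> k"
proof -
  define V where "V = (\<lambda>z. L2_inner g (tf_shift z gaussian))"
  have cont: "continuous_on UNIV g" and V: "integrable lborel V"
    and [measurable]: "g \<in> borel_measurable borel" and g2: "integrable lborel (\<lambda>t. (cmod (g t))\<^sup>2)"
    using g by (auto simp: M1_space_def L2_space_def V_def)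
  note gaussian_L2(1)[measurable]
  have [measurable]: "V \<in> borel_measurable (borel \<Otimes>\<^sub>M borel)"
    using V by (auto simp: borel_prod)
  \<comment> \<open>Kept in \<open>ennreal\<close>, since integrability of \<open>V\<close> makes
    only almost every slice integrable.\<close>
  define \<Gamma> where "\<Gamma> x = (\<integral>\<^sup>+\<omega>. ennreal (cmod (V (x, \<omega>))) \<partial>lborel)" for x
  have [measurable]: "\<Gamma> \<in> borel_measurable borel"
    unfolding \<Gamma>_def by measurable
  have \<Gamma>_fin: "(\<integral>\<^sup>+x. \<Gamma> x \<partial>lborel) < \<infinity>"
  proof -
    have "(\<integral>\<^sup>+x. \<Gamma> x \<partial>lborel) = (\<integral>\<^sup>+z. ennreal (cmod (V z)) \<partial>(lborel \<Otimes>\<^sub>M lborel))"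
      unfolding \<Gamma>_def by (rule lborel.nn_integral_fst) measurable
    then show ?thesis using V by (simp add: lborel_prod integrable_iff_bounded)
  qed
  have V_eq: "V (x, \<omega>) = (LINT t|lborel. (g t * gaussian (t - x)) * cis (- (2 * pi * \<omega> * t)))" for x \<omega>
  proof -
    have "g t * cnj (tf_shift (x, \<omega>) gaussian t) = (g t * gaussian (t - x)) * cis (- (2 * pi * \<omega> * t))"
      for t
    proof -
      have "exp (2 * pi * \<i> * \<omega> * t) = cis (2 * pi * \<omega> * t)"
        by (simp add: cis_conv_exp mult_ac)
      then show ?thesis
        by (simp add: tf_shift_def modulation_def translation_def gaussian_def cis_cnj mult_ac)
    qed
    then show ?thesis unfolding V_def L2_inner_def by (simp only:)
  qed
  have F_int: "integrable lborel (\<lambda>t. g t * gaussian (t - x))" for x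
  proof (rule Bochner_Integration.integrable_bound[where f = "\<lambda>t. (cmod (g t))\<^sup>2 + (cmod (gaussian (t - x)))\<^sup>2"])
    show "integrable lborel (\<lambda>t. (cmod (g t))\<^sup>2 + (cmod (gaussian (t - x)))\<^sup>2)"
      using g2 gaussian_L2(2)[of x] by (rule Bochner_Integration.integrable_add)
    have "a * b \<le> a\<^sup>2 + b\<^sup>2" if "a \<ge> 0" "b \<ge> 0" for a b :: real
      using sum_squares_bound[of a b] mult_nonneg_nonneg[OF that] by linarith
    then show "AE t in lborel. cmod (g t * gaussian (t - x)) \<le> norm ((cmod (g t))\<^sup>2 + (cmod (gaussian (t - x)))\<^sup>2)"
      by (auto simp: norm_mult)
  qed measurable
  \<comment> \<open>An infinite \<open>\<Gamma> x\<close> makes the bound trivial, so it holds for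
    every \<open>x\<close> and no exceptional null set has to be carried along.\<close>
  have pt: "ennreal (cmod (g t * gaussian (t - x))) \<le> \<Gamma> x" for t x
  proof (cases "\<Gamma> x = \<infinity>")
    case False
    then have int: "integrable lborel (\<lambda>\<omega>. V (x, \<omega>))"
      by (simp add: integrable_iff_bounded \<Gamma>_def less_top)
    have "cmod (g t * gaussian (t - x)) \<le> (LINT \<omega>|lborel. cmod (V (x, \<omega>)))"
      unfolding V_eq
    proof (rule norm_le_integral_fourier[where F = "\<lambda>t. g t * gaussian (t - x)"])
      show "isCont (\<lambda>t. g t * gaussian (t - x)) t"
        using cont unfolding gaussian_def
        by (auto intro!: continuous_intros simp: continuous_on_eq_continuous_at)
    qed (use F_int int in \<open>simp_all add: V_eq\<close>)
    also have "ennreal \<dots> = \<Gamma> x"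
      unfolding \<Gamma>_def using int by (intro nn_integral_eq_integral[symmetric]) auto
    finally show ?thesis by (simp add: ennreal_leI)
  qed simp
  \<comment> \<open>exp (- pi) is the smallest value of the Gaussian on [-1, 1]; hence the factor
    exp pi.\<close>
  have pt': "ennreal (cmod (g t)) \<le> ennreal (exp pi) * \<Gamma> x" if "\<bar>t - x\<bar> \<le> 1" for t x
  proof -
    have "(t - x)\<^sup>2 \<le> 1" using that by (simp add: abs_square_le_1)
    then have "exp (- pi) \<le> cmod (gaussian (t - x))"
      by (simp add: gaussian_def norm_exp_eq_Re flip: exp_of_real)
    then have "1 \<le> exp pi * cmod (gaussian (t - x))"
      by (simp add: exp_minus field_simps)
    then have "cmod (g t) * 1 \<le> cmod (g t) * (exp pi * cmod (gaussian (t - x)))"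
      by (rule mult_left_mono) simp
    then have "ennreal (cmod (g t)) \<le> ennreal (exp pi * cmod (g t * gaussian (t - x)))"
      by (intro ennreal_leI) (simp add: norm_mult mult_ac)
    also have "\<dots> \<le> ennreal (exp pi) * \<Gamma> x"
      by (simp add: ennreal_mult pt mult_left_mono)
    finally show ?thesis .
  qed
  \<comment> \<open>The cells are half-open and hence disjoint, so the \<open>\<gamma> k\<close> add
    up to at most the integral of \<open>\<Gamma>\<close>.\<close>
  define \<gamma> where "\<gamma> k = (\<integral>\<^sup>+x. \<Gamma> x * indicator {of_int k..<of_int k + 1} x \<partial>lborel)" for k :: int
  have fin: "(\<Sum>k\<in>I. \<gamma> k) \<le> (\<integral>\<^sup>+x. \<Gamma> x \<partial>lborel)" if "finite I" for I
  proof -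
    have "(\<Sum>k\<in>I. \<gamma> k) = (\<integral>\<^sup>+x. (\<Sum>k\<in>I. \<Gamma> x * indicator {of_int k..<of_int k + 1} x) \<partial>lborel)"
      unfolding \<gamma>_def by (rule nn_integral_sum[symmetric]) measurable
    also have "\<dots> \<le> (\<integral>\<^sup>+x. \<Gamma> x \<partial>lborel)"
    proof (rule nn_integral_mono)
      fix x :: real
      have "(\<Sum>k\<in>I. \<Gamma> x * indicator {of_int k..<of_int k + 1} x) = (\<Sum>k\<in>I. if k = \<lfloor>x\<rfloor> then \<Gamma> x else 0)"
        by (intro sum.cong refl) (auto simp: indicator_def floor_eq_iff, linarith+)
      also have "\<dots> \<le> \<Gamma> x" using that by (simp add: sum.delta)
      finally show "(\<Sum>k\<in>I. \<Gamma> x * indicator {of_int k..<of_int k + 1} x) \<le> \<Gamma> x" .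
    qed
    finally show ?thesis .
  qed
  have \<gamma>_fin: "\<gamma> k < \<infinity>" for k
    using fin[of "{k}"] \<Gamma>_fin by simp
  define \<beta> where "\<beta> k = exp pi * enn2real (\<gamma> k)" for k
  show ?thesis
  proof (rule that)
    have "(\<lambda>k. enn2real (\<gamma> k)) summable_on UNIV"
    proof (rule nonneg_bdd_above_summable_on)
      show "bdd_above (sum (\<lambda>k. enn2real (\<gamma> k)) ` {F. F \<subseteq> UNIV \<and> finite F})"
      proof (rule bdd_aboveI2)
        fix F :: "int set" assume "F \<in> {F. F \<subseteq> UNIV \<and> finite F}"
        then have F: "finite F" by simp
        have "ennreal (\<Sum>k\<in>F. enn2real (\<gamma> k)) = (\<Sum>k\<in>F. \<gamma> k)"
          using \<gamma>_fin by (subst sum_ennreal[symmetric]) auto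
        also have "\<dots> \<le> (\<integral>\<^sup>+x. \<Gamma> x \<partial>lborel)" by (rule fin[OF F])
        also have "\<dots> = ennreal (enn2real (\<integral>\<^sup>+x. \<Gamma> x \<partial>lborel))" using \<Gamma>_fin by simp
        finally show "(\<Sum>k\<in>F. enn2real (\<gamma> k)) \<le> enn2real (\<integral>\<^sup>+x. \<Gamma> x \<partial>lborel)"
          by (simp add: ennreal_le_iff)
      qed
    qed simp
    then show "\<beta> summable_on UNIV"
      unfolding \<beta>_def by (rule summable_on_cmult_right)
    fix k :: int and t :: real assume t: "t \<in> {of_int k..of_int k + 1}"
    \<comment> \<open>The constant |g t| is averaged over a unit cell of \<open>x\<close>. Every
      such \<open>x\<close> is within distance 1 of \<open>t\<close>, also when \<open>t\<close> is
      the right end of the closed interval.\<close>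
    have "ennreal (cmod (g t)) = (\<integral>\<^sup>+x. ennreal (cmod (g t)) * indicator {real_of_int k..<of_int k + 1} x \<partial>lborel)"
      by (subst nn_integral_cmult_indicator) auto
    also have "\<dots> \<le> (\<integral>\<^sup>+x. ennreal (exp pi) * (\<Gamma> x * indicator {of_int k..<of_int k + 1} x) \<partial>lborel)"
      using t by (intro nn_integral_mono) (auto simp: indicator_def abs_le_iff intro!: pt')
    also have "\<dots> = ennreal (exp pi) * \<gamma> k"
      unfolding \<gamma>_def by (rule nn_integral_cmult) measurable
    also have "\<dots> = ennreal (\<beta> k)"
      using \<gamma>_fin[of k] by (simp add: \<beta>_def ennreal_mult)
    finally show "cmod (g t) \<le> \<beta> k"
      by (simp add: \<beta>_def ennreal_le_iff)
  qed
qed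

subsection \<open>Test functions\<close>

lemma tf_shift_eq: "tf_shift (a, b) f t = cis (2 * pi * b * t) * f (t - a)"
  by (simp add: tf_shift_def modulation_def translation_def cis_conv_exp mult_ac)

lemma continuous_on_tf_shift:
  assumes "continuous_on UNIV f"
  shows "continuous_on UNIV (tf_shift \<gamma> f)"
proof -
  have "continuous_on UNIV (\<lambda>t. cis (2 * pi * snd \<gamma> * t) * f (t - fst \<gamma>))"
    by (intro continuous_intros continuous_on_compose2[OF assms]) auto
  then show ?thesis
    by (cases \<gamma>) (simp add: tf_shift_eq[abs_def])
qed

text \<open>Composing two shifts costs only the unimodular phase
  \<open>cis (2 * pi * b * x)\<close>. This is what makes the two systems of the theorem
  equivalent.\<close>

lemma cmod_L2_inner_tf_shift_add:
  "cmod (L2_inner f (tf_shift (\<gamma> + z) g)) = cmod (L2_inner f (tf_shift \<gamma> (tf_shift z g)))"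
proof -
  obtain x \<omega> a b where \<gamma>: "\<gamma> = (x, \<omega>)" and z: "z = (a, b)" by fastforce
  have "tf_shift (\<gamma> + z) g t = cis (2 * pi * b * x) * tf_shift \<gamma> (tf_shift z g) t"
    for t
  proof -
    have "cis (2 * pi * (\<omega> + b) * t) = cis (2 * pi * b * x) * (cis (2 * pi * \<omega> * t) * cis (2 * pi * b * (t - x)))"
      by (simp add: cis_mult algebra_simps)
    then show ?thesis
      by (simp add: \<gamma> z tf_shift_eq diff_diff_eq mult.assoc)
  qed
  then have "L2_inner f (tf_shift (\<gamma> + z) g)
      = (LINT t|lborel. cnj (cis (2 * pi * b * x)) * (f t * cnj (tf_shift \<gamma> (tf_shift z g) t)))"
    by (simp add: L2_inner_def mult_ac)
  also have "\<dots> = cnj (cis (2 * pi * b * x)) * L2_inner f (tf_shift \<gamma> (tf_shift z g))"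
    by (simp add: L2_inner_def)
  finally show ?thesis by (simp add: norm_mult)
qed

text \<open>
  On \<open>[0,1)\<^sup>2\<close> the Zak transform of \<open>comb N\<close> is, up to null sets, the indicator of \<open>x \<le> 1/N\<close> times
  the Dirichlet-type kernel \<open>\<Sum>k<N. exp (2 \<pi> \<i> k \<omega>)\<close>.
\<close>

definition comb :: "nat \<Rightarrow> real \<Rightarrow> complex" where
  "comb N t = of_real (\<Sum>k<N. indicator {real k - 1 / real N..real k} t)"

lemma comb_L2: "comb N \<in> L2_space"
  and comb_norm: "N > 0 \<Longrightarrow> 1 \<le> (L2_norm (comb N))\<^sup>2"
proof -
  define A where "A k = {real k - 1 / real N..real k}" for k
  have sq: "(cmod (comb N t))\<^sup>2 = (\<Sum>k<N. \<Sum>l<N. indicator (A k \<inter> A l) t)" for t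
    unfolding comb_def A_def[symmetric] norm_of_real power2_abs
    unfolding power2_eq_square sum_product by (simp only: indicator_inter_arith)
  have fin: "emeasure lborel (A k \<inter> A l) < \<infinity>" for k l
    by (rule le_less_trans[OF emeasure_mono[of _ "A k"]]) (auto simp: A_def)
  have int: "integrable lborel (indicator (A k \<inter> A l) :: real \<Rightarrow> real)" for k l
    using fin by (simp add: integrable_indicator_iff A_def)
  have int2: "integrable lborel (\<lambda>t. (cmod (comb N t))\<^sup>2)"
    unfolding sq using int by (intro Bochner_Integration.integrable_sum) auto
  have "comb N \<in> borel_measurable borel"
    unfolding comb_def by measurable
  then show "comb N \<in> L2_space"
    using int2 by (simp add: L2_space_def)
  assume N: "N > 0"
  have intA: "integrable lborel (indicator (A k) :: real \<Rightarrow> real)" for k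
    using int[of k k] by simp
  have "(LINT t|lborel. (\<Sum>k<N. indicator (A k) t :: real)) = (\<Sum>k<N. 1 / real N)"
    using intA by (subst Bochner_Integration.integral_sum) (auto simp: A_def)
  then have "1 = (LINT t|lborel. (\<Sum>k<N. indicator (A k) t :: real))"
    using N by simp
  also have "\<dots> \<le> (LINT t|lborel. (cmod (comb N t))\<^sup>2)"
  proof (rule integral_mono)
    fix t
    \<comment> \<open>Only the diagonal of the nonnegative double sum is kept.\<close>
    have "(\<Sum>k<N. indicator (A k) t :: real) = (\<Sum>k<N. \<Sum>l\<in>{k}. indicator (A k \<inter> A l) t)" by simp
    also have "\<dots> \<le> (\<Sum>k<N. \<Sum>l<N. indicator (A k \<inter> A l) t)"
      by (intro sum_mono sum_mono2) auto
    finally show "(\<Sum>k<N. indicator (A k) t) \<le> (cmod (comb N t))\<^sup>2" by (simp add: sq)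
  qed (use intA int2 in \<open>auto intro!: Bochner_Integration.integrable_sum\<close>)
  finally show "1 \<le> (L2_norm (comb N))\<^sup>2"
    by (simp add: L2_norm_def)
qed

section \<open>Gabor coefficients of the combs\<close>

lemma comb_inner:
  assumes h: "continuous_on UNIV h"
  shows "L2_inner (comb N) (tf_shift (of_int j, of_int l) h)
    = cnj (LINT x|lborel. (indicator {0..1 / real N} x *\<^sub>R (\<Sum>k<N. h (of_int (int k - j) - x)))
        * cis (- (2 * pi * of_int l * x)))"
proof -
  define u where "u t = cnj (tf_shift (of_int j, of_int l) h t)" for t
  have u: "continuous_on S u" for S
    unfolding u_def by (intro continuous_intros continuous_on_subset[OF continuous_on_tf_shift[OF h]]) auto
  \<comment> \<open>Integer modulations do not see the integer \<open>k\<close>, so all intervals of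
    the comb can be folded onto the same one. Pulling out the conjugation leaves an ordinary Fourier
    coefficient.\<close>
  have shift: "u (real k - x) = cnj (h (of_int (int k - j) - x) * cis (- (2 * pi * of_int l * x)))" for k x
  proof -
    have "cis (2 * pi * of_int l * (real k - x)) = cis (- (2 * pi * of_int l * x)) * cis (2 * pi * of_int (l * int k))"
      by (simp add: cis_mult algebra_simps)
    also have "cis (2 * pi * of_int (l * int k)) = 1"
      by (rule cis_multiple_2pi) simp
    finally show ?thesis by (simp add: u_def tf_shift_eq algebra_simps)
  qed
  have "L2_inner (comb N) (tf_shift (of_int j, of_int l) h)
      = (LINT t|lborel. (\<Sum>k<N. indicator {real k - 1 / real N..real k} t *\<^sub>R u t))"
    by (simp add: L2_inner_def comb_def u_def sum_distrib_right scaleR_conv_of_real)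
  also have "\<dots> = (\<Sum>k<N. LINT t|lborel. indicator {real k - 1 / real N..real k} t *\<^sub>R u t)"
    by (intro Bochner_Integration.integral_sum borel_integrable_compact u) auto
  \<comment> \<open>The reflection t = k - x carries the k-th interval to [0, 1/N] and matches the
    argument k - x in \<open>zak\<close>.\<close>
  also have "\<dots> = (\<Sum>k<N. LINT x|lborel. indicator {0..1 / real N} x *\<^sub>R u (real k - x))"
  proof (rule sum.cong[OF refl])
    fix k
    have "(LINT t|lborel. indicator {real k - 1 / real N..real k} t *\<^sub>R u t)
        = \<bar>- 1\<bar> *\<^sub>R (LINT x|lborel. indicator {real k - 1 / real N..real k} (real k + - 1 * x) *\<^sub>R u (real k + - 1 * x))"
      by (rule lborel_integral_real_affine) simp
    also have "\<dots> = (LINT x|lborel. indicator {real k - 1 / real N..real k} (real k - x) *\<^sub>R u (real k - x))"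
      by simp
    also have "\<dots> = (LINT x|lborel. indicator {0..1 / real N} x *\<^sub>R u (real k - x))"
      by (intro Bochner_Integration.integral_cong refl) (auto simp: indicator_def)
    finally show "(LINT t|lborel. indicator {real k - 1 / real N..real k} t *\<^sub>R u t)
        = (LINT x|lborel. indicator {0..1 / real N} x *\<^sub>R u (real k - x))" .
  qed
  also have "\<dots> = (LINT x|lborel. (\<Sum>k<N. indicator {0..1 / real N} x *\<^sub>R u (real k - x)))"
    by (intro Bochner_Integration.integral_sum[symmetric] borel_integrable_compact
        continuous_on_compose2[OF u[of UNIV]] continuous_intros) auto
  also have "\<dots> = (LINT x|lborel. cnj ((indicator {0..1 / real N} x *\<^sub>R (\<Sum>k<N. h (of_int (int k - j) - x)))
        * cis (- (2 * pi * of_int l * x))))"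
    unfolding shift
    by (intro Bochner_Integration.integral_cong refl) 
      (simp add: sum_distrib_left sum_distrib_right mult_ac scaleR_sum_right)
  finally show ?thesis by (simp only: Bochner_Integration.integral_cnj)
qed

text \<open>For fixed \<open>j\<close> the sum over \<open>l\<close> falls to Bessel's inequality,
  as the folded function lives on [0, 1/N], inside [0, 1]. The sum over \<open>j\<close> is then
  taken under the integral, and the length of the interval supplies the factor 1/N.\<close>

lemma comb_coefficients_le:
  fixes h :: "real \<Rightarrow> complex"
  assumes h: "continuous_on UNIV h" and N: "N > 0" and J: "finite J" and L: "finite L"
    and D: "\<And>x. x \<in> {0..1 / real N} \<Longrightarrow> (\<Sum>j\<in>J. (cmod (\<Sum>k<N. h (of_int (int k - j) - x)))\<^sup>2) \<le> D"
  shows "(\<Sum>j\<in>J. \<Sum>l\<in>L. (cmod (L2_inner (comb N) (tf_shift (of_int j, of_int l) h)))\<^sup>2) \<le> D / real N"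
proof -
  define S where "S j x = (\<Sum>k<N. h (of_int (int k - j) - x))" for j x
  define \<Phi> where "\<Phi> j x = indicator {0..1 / real N} x *\<^sub>R S j x" for j x
  have S: "continuous_on X (S j)" for X j
    unfolding S_def by (intro continuous_intros continuous_on_compose2[OF h]) auto
  have int: "integrable lborel (\<lambda>x. indicator {0..1 / real N} x *\<^sub>R (cmod (S j x))\<^sup>2)" for j
    by (intro borel_integrable_compact continuous_intros S) auto
  have le1: "1 / real N \<le> 1" using N by simp
  have "(\<Sum>l\<in>L. (cmod (L2_inner (comb N) (tf_shift (of_int j, of_int l) h)))\<^sup>2)
      \<le> (LINT x|lborel. indicator {0..1 / real N} x *\<^sub>R (cmod (S j x))\<^sup>2)" for j
  proof -
    have "compact (S j ` {0..1 / real N})"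
      by (intro compact_continuous_image S) auto
    then obtain C where C: "\<And>x. x \<in> {0..1 / real N} \<Longrightarrow> cmod (S j x) \<le> C"
      by (meson bounded_iff compact_imp_bounded image_eqI)
    have "(\<Sum>l\<in>L. (cmod (LINT x|lborel. \<Phi> j x * cis (- (2 * pi * of_int l * x))))\<^sup>2)
           \<le> (LINT x|lborel. (cmod (\<Phi> j x))\<^sup>2)"
    proof (rule bessel_unit_interval[OF _ _ _ L])
      have "S j \<in> borel_measurable borel" by (intro borel_measurable_continuous_onI S)
      then show "\<Phi> j \<in> borel_measurable borel" unfolding \<Phi>_def by measurable
      show "cmod (\<Phi> j x) \<le> max C 0" for x
        using C[of x] by (auto simp: \<Phi>_def indicator_def)
      show "\<Phi> j x = 0" if "x \<notin> {0..1}" for x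
        using that le1 by (auto simp: \<Phi>_def indicator_def)
    qed
    also have "(LINT x|lborel. (cmod (\<Phi> j x))\<^sup>2) = (LINT x|lborel. indicator {0..1 / real N} x *\<^sub>R (cmod (S j x))\<^sup>2)"
      by (intro Bochner_Integration.integral_cong refl) (auto simp: \<Phi>_def indicator_def)
    finally show ?thesis by (simp add: comb_inner[OF h] \<Phi>_def S_def)
  qed
  then have "(\<Sum>j\<in>J. \<Sum>l\<in>L. (cmod (L2_inner (comb N) (tf_shift (of_int j, of_int l) h)))\<^sup>2)
      \<le> (\<Sum>j\<in>J. LINT x|lborel. indicator {0..1 / real N} x *\<^sub>R (cmod (S j x))\<^sup>2)"
    by (intro sum_mono)
  also have "\<dots> = (LINT x|lborel. (\<Sum>j\<in>J. indicator {0..1 / real N} x *\<^sub>R (cmod (S j x))\<^sup>2))"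
    by (rule Bochner_Integration.integral_sum[symmetric]) (rule int)
  also have "\<dots> \<le> (LINT x|lborel. indicator {0..1 / real N} x *\<^sub>R D)"
  proof (rule integral_mono)
    show "integrable lborel (\<lambda>x. \<Sum>j\<in>J. indicator {0..1 / real N} x *\<^sub>R (cmod (S j x))\<^sup>2)"
      using int by (intro Bochner_Integration.integrable_sum)
    show "integrable lborel (\<lambda>x. indicator {0..1 / real N} x *\<^sub>R D)"
      by (intro borel_integrable_compact continuous_intros) auto
    show "(\<Sum>j\<in>J. indicator {0..1 / real N} x *\<^sub>R (cmod (S j x))\<^sup>2) \<le> indicator {0..1 / real N} x *\<^sub>R D" for x
      using D[of x] by (auto simp: indicator_def S_def)
  qed
  also have "\<dots> = D / real N"
    by simp
  finally show ?thesis .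
qed

text \<open>With C the sum of \<open>\<beta>\<close>, \<open>window_sums\<close> gives a bound 3
  \<eta> N C plus a term free of N; the factor 1/N from \<open>comb_coefficients_le\<close> leaves 3
  \<eta> C in the limit. Hypothesis \<open>zero\<close> says that the Zak transform of
  \<open>h\<close> vanishes at the origin, which makes the central partial sum small.\<close>

lemma comb_coefficients_tendsto_0:
  fixes h :: "real \<Rightarrow> complex" and \<beta> :: "int \<Rightarrow> real"
  assumes h: "continuous_on UNIV h" and \<beta>: "\<beta> summable_on UNIV"
    and bnd: "\<And>n x. x \<in> {0..1} \<Longrightarrow> cmod (h (of_int n - x)) \<le> \<beta> n"
    and zero: "(\<Sum>\<^sub>\<infinity>n\<in>(UNIV :: int set). h (of_int n)) = 0" and \<epsilon>: "\<epsilon> > 0"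
  shows "eventually (\<lambda>N. \<forall>F. finite F \<and> F \<subseteq> \<int> \<times> \<int> \<longrightarrow>
    (\<Sum>\<gamma>\<in>F. (cmod (L2_inner (comb N) (tf_shift \<gamma> h)))\<^sup>2) \<le> \<epsilon>) sequentially"
proof -
  define C where "C = infsum \<beta> UNIV"
  have \<beta>0: "\<beta> n \<ge> 0" for n
    using order_trans[OF norm_ge_zero bnd[of 0 n]] by simp
  have C0: "C \<ge> 0" unfolding C_def using \<beta>0 by (intro infsum_nonneg)
  \<comment> \<open>Half of \<open>\<epsilon>\<close> goes to the main term, the other half to the
    boundary windows; the added 1 keeps the denominator positive when C = 0.\<close>
  define \<eta> where "\<eta> = \<epsilon> / (6 * (C + 1))"
  have \<eta>: "\<eta> > 0" using C0 \<epsilon> by (simp add: \<eta>_def)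
  have \<eta>C: "3 * \<eta> * C \<le> \<epsilon> / 2"
    using C0 \<epsilon> by (simp add: \<eta>_def field_simps)
  have "eventually (\<lambda>F. dist (sum \<beta> F) C < \<eta>) (finite_subsets_at_top UNIV)"
    using infsum_tendsto[OF \<beta>] \<eta> unfolding C_def by (rule tendstoD)
  then obtain X where X: "finite X" "\<And>Y. finite Y \<Longrightarrow> X \<subseteq> Y \<Longrightarrow> dist (sum \<beta> Y) C < \<eta>"
    unfolding eventually_finite_subsets_at_top by auto
  \<comment> \<open>A crude bound for the absolute values in \<open>X\<close>, valid also when
    \<open>X\<close> is empty.\<close>
  define K where "K = nat (\<Sum>n\<in>X. \<bar>n\<bar>)"
  define I where "I = {- int K..int K}"
  have "\<bar>n\<bar> \<le> int K" if "n \<in> X" for n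
    unfolding K_def using member_le_sum[OF that, of abs] X(1) by simp
  then have "X \<subseteq> I" by (force simp: I_def abs_le_iff)
  then have distI: "dist (sum \<beta> I) C < \<eta>" using X(2)[of I] by (simp add: I_def)
  have summ: "f summable_on A" if "f summable_on UNIV" for f :: "int \<Rightarrow> 'a::banach" and A
    using that by (rule summable_on_subset_banach) simp
  have split: "infsum f UNIV = sum f I + infsum f (- I)" if "f summable_on UNIV" for f :: "int \<Rightarrow> 'a::banach"
  proof -
    have "infsum f (I \<union> - I) = infsum f I + infsum f (- I)"
      using summ[OF that] by (intro infsum_Un_disjoint) auto
    then show ?thesis by (simp add: I_def)
  qed
  have tail: "infsum \<beta> (- I) \<le> \<eta>"
    using distI split[OF \<beta>] by (simp add: C_def dist_real_def)
  have hsum: "(\<lambda>n. h (of_int n)) summable_on UNIV"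
    by (rule abs_summable_summable, rule Infinite_Sum.abs_summable_on_comparison_test'[OF \<beta>])
       (use bnd[of 0] in simp)
  \<comment> \<open>As the full series is 0, its part over \<open>I\<close> is minus its tail, which
    \<open>\<beta>\<close> controls.\<close>
  have "cmod (infsum (\<lambda>n. h (of_int n)) (- I)) \<le> infsum \<beta> (- I)"
    by (rule norm_infsum_le[OF has_sum_infsum has_sum_infsum]) (use summ[OF hsum] summ[OF \<beta>] bnd[of 0] in auto)
  then have centre0: "cmod (\<Sum>n\<in>I. h (of_int n)) \<le> \<eta>"
    using split[OF hsum] zero tail by (simp add: add_eq_0_iff2)
  define P where "P x = (\<Sum>n\<in>I. h (of_int n - x))" for x
  have "continuous_on UNIV P"
    unfolding P_def by (intro continuous_intros continuous_on_compose2[OF h]) auto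
  then have "isCont P 0"
    by (simp add: continuous_on_eq_continuous_at)
  then obtain d where d: "d > 0" "\<And>x. dist x 0 < d \<Longrightarrow> dist (P x) (P 0) < \<eta>"
    using \<eta> unfolding continuous_at_eps_delta by metis
  \<comment> \<open>The second \<eta> pays for moving from 0 to \<open>x\<close>; this is why
    \<open>window_sums\<close> allows 2 \<eta> at the centre. The points of [0, 1/N] qualify once
    1/N < d.\<close>
  have P_small: "cmod (P x) \<le> 2 * \<eta>" if "\<bar>x\<bar> < d" for x
    using d(2)[of x] that centre0 norm_triangle_ineq2[of "P x" "P 0"] by (simp add: dist_norm P_def)
  have "(\<lambda>N. 1 / real N) \<longlonglongrightarrow> 0" by real_asymp
  then have ev1: "eventually (\<lambda>N. 1 / real N < d) sequentially"
    using d(1) by (rule order_tendstoD)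
  have "(\<lambda>N. 4 * real K * C\<^sup>2 / real N) \<longlonglongrightarrow> 0" by real_asymp
  then have ev2: "eventually (\<lambda>N. 4 * real K * C\<^sup>2 / real N < \<epsilon> / 2) sequentially"
    by (rule order_tendstoD) (use \<epsilon> in simp)
  show ?thesis
    using ev1 ev2 eventually_gt_at_top[of 0]
  proof eventually_elim
    case (elim N)
    show ?case
    proof (intro allI impI, elim conjE)
      fix F :: "(real \<times> real) set" assume F: "finite F" "F \<subseteq> \<int> \<times> \<int>"
      define \<iota> where "\<iota> = (\<lambda>(j, l). (real_of_int j, real_of_int l))"
      define J where "J = (\<lambda>\<gamma>. \<lfloor>fst \<gamma>\<rfloor>) ` F"
      define L where "L = (\<lambda>\<gamma>. \<lfloor>snd \<gamma>\<rfloor>) ` F"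
      have fin: "finite J" "finite L" using F by (auto simp: J_def L_def)
      \<comment> \<open>A finite set of lattice points is enlarged to a product, which separates the
        sums over translations and modulations.\<close>
      have "F \<subseteq> \<iota> ` (J \<times> L)"
      proof
        fix \<gamma> assume "\<gamma> \<in> F"
        moreover from this have "\<gamma> = \<iota> (\<lfloor>fst \<gamma>\<rfloor>, \<lfloor>snd \<gamma>\<rfloor>)"
          using F(2) by (auto simp: \<iota>_def elim!: Ints_cases)
        ultimately show "\<gamma> \<in> \<iota> ` (J \<times> L)"
          unfolding J_def L_def by blast
      qed
      then have "(\<Sum>\<gamma>\<in>F. (cmod (L2_inner (comb N) (tf_shift \<gamma> h)))\<^sup>2)
          \<le> (\<Sum>\<gamma>\<in>\<iota> ` (J \<times> L). (cmod (L2_inner (comb N) (tf_shift \<gamma> h)))\<^sup>2)"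
        using fin by (intro sum_mono2) auto
      also have "\<dots> = (\<Sum>p\<in>J \<times> L. (cmod (L2_inner (comb N) (tf_shift (\<iota> p) h)))\<^sup>2)"
        by (subst sum.reindex) (auto simp: inj_on_def \<iota>_def)
      also have "\<dots> = (\<Sum>j\<in>J. \<Sum>l\<in>L. (cmod (L2_inner (comb N) (tf_shift (of_int j, of_int l) h)))\<^sup>2)"
        by (simp add: \<iota>_def sum.cartesian_product split_def)
      also have "\<dots> \<le> (3 * \<eta> * (real N * C) + 4 * real K * C\<^sup>2) / real N"
      proof (rule comb_coefficients_le[OF h \<open>0 < N\<close> fin])
        fix x assume x: "x \<in> {0..1 / real N}"
        also have "{0..1 / real N} \<subseteq> {0..1}" using \<open>0 < N\<close> by auto
        finally have x1: "x \<in> {0..1}" .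
        have "\<bar>x\<bar> < d" using x elim by auto
        then show "(\<Sum>j\<in>J. (cmod (\<Sum>k<N. h (of_int (int k - j) - x)))\<^sup>2)
            \<le> 3 * \<eta> * (real N * C) + 4 * real K * C\<^sup>2"
          unfolding C_def
          using tail P_small[of x] unfolding P_def I_def
          by (intro window_sums[where H = "\<lambda>n. h (of_int n - x)"] bnd[OF x1] \<beta> fin) auto
      qed
      also have "\<dots> = 3 * \<eta> * C + 4 * real K * C\<^sup>2 / real N"
        using \<open>0 < N\<close> by (simp add: field_simps)
      also have "\<dots> \<le> \<epsilon>"
        using \<eta>C elim by simp
      finally show "(\<Sum>\<gamma>\<in>F. (cmod (L2_inner (comb N) (tf_shift \<gamma> h)))\<^sup>2) \<le> \<epsilon>" .
    qed
  qed
qed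

text \<open>At the integers \<open>tf_shift z g\<close> takes the values that \<open>zak g z\<close>
  sums, so a zero of the Zak transform of \<open>g\<close> at \<open>z\<close> becomes one of the
  shifted window at the origin.\<close>

lemma comb_coefficients_zak_zero:
  assumes g: "g \<in> M1_space" and z: "z \<in> {0..<1} \<times> {0..<1}" and zero: "zak g z = 0" and \<epsilon>: "\<epsilon> > 0"
  shows "eventually (\<lambda>N. \<forall>F. finite F \<and> F \<subseteq> \<int> \<times> \<int> \<longrightarrow>
    (\<Sum>\<gamma>\<in>F. (cmod (L2_inner (comb N) (tf_shift \<gamma> (tf_shift z g))))\<^sup>2) \<le> \<epsilon>) sequentially"
proof -
  obtain a b where ab: "z = (a, b)" by fastforce
  with z have a: "0 \<le> a" "a < 1" by auto
  obtain \<beta> :: "int \<Rightarrow> real" where \<beta>: "\<beta> summable_on UNIV"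
    "\<And>k t. t \<in> {of_int k..of_int k + 1} \<Longrightarrow> cmod (g t) \<le> \<beta> k"
    using M1_space_wiener[OF g] by blast
  have \<beta>0: "\<beta> n \<ge> 0" for n
    using order_trans[OF norm_ge_zero \<beta>(2)[of "of_int n" n]] by simp
  have shift: "(\<lambda>n. \<beta> (n - c)) summable_on UNIV" for c
    using \<beta>(1) by (subst summable_on_reindex_bij_betw[of "\<lambda>n. n - c" UNIV UNIV \<beta>])
      (auto intro!: bij_betwI[where g = "\<lambda>n. n + c"])
  show ?thesis
  proof (rule comb_coefficients_tendsto_0[OF _ _ _ _ \<epsilon>])
    show "continuous_on UNIV (tf_shift z g)"
      using g by (intro continuous_on_tf_shift) (auto simp: M1_space_def)
    \<comment> \<open>With \<open>a\<close> in [0, 1) and \<open>x\<close> in [0, 1], the point n -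
      x - a lies in (n - 2, n], which two consecutive unit cells cover.\<close>
    show "(\<lambda>n. \<beta> (n - 2) + \<beta> (n - 1)) summable_on UNIV"
      by (intro summable_on_add shift)
    show "cmod (tf_shift z g (of_int n - x)) \<le> \<beta> (n - 2) + \<beta> (n - 1)" if "x \<in> {0..1}" for n x
    proof -
      have "of_int n - x - a \<in> {of_int (n - 2)..of_int (n - 2) + 1} \<or>
            of_int n - x - a \<in> {of_int (n - 1)..of_int (n - 1) + 1}"
        using that a by auto
      then have "cmod (g (of_int n - x - a)) \<le> \<beta> (n - 2) + \<beta> (n - 1)"
        using \<beta>(2) \<beta>0[of "n - 1"] \<beta>0[of "n - 2"] by (smt (verit))
      then show ?thesis by (simp add: ab tf_shift_eq norm_mult)
    qed
    have "tf_shift z g (of_int n) = g (of_int n - a) * exp (2 * pi * \<i> * n * b)" for n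
      by (simp add: ab tf_shift_eq cis_conv_exp mult_ac)
    then show "(\<Sum>\<^sub>\<infinity>n\<in>(UNIV :: int set). tf_shift z g (of_int n)) = 0"
      using zero by (simp add: zak_def ab)
  qed
qed

section \<open>Violation of the lower frame bound\<close>

lemma infsum_ennreal_le:
  fixes f :: "'a \<Rightarrow> real"
  assumes "\<And>x. x \<in> A \<Longrightarrow> f x \<ge> 0" and "\<And>F. finite F \<Longrightarrow> F \<subseteq> A \<Longrightarrow> sum f F \<le> B"
  shows "(\<Sum>\<^sub>\<infinity>x\<in>A. ennreal (f x)) \<le> ennreal B"
proof (rule infsum_le_finite_sums)
  fix F assume F: "finite F" "F \<subseteq> A"
  then have "(\<Sum>x\<in>F. ennreal (f x)) = ennreal (sum f F)"
    using assms(1) by (intro sum_ennreal) auto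
  also have "\<dots> \<le> ennreal B"
    using assms(2)[OF F] by (rule ennreal_leI)
  finally show "(\<Sum>x\<in>F. ennreal (f x)) \<le> ennreal B" .
qed (auto intro!: nonneg_summable_on_complete)

theorem theorem3p1:
  fixes g :: "real \<Rightarrow> complex" and M :: nat and z :: "nat \<Rightarrow> real \<times> real"
  assumes "g \<in> M1_space"
    and "\<And>m. m \<in> {1..M} \<Longrightarrow> z m \<in> {0..<1} \<times> {0..<1}"
    and "inj_on z {1..M}"
    and "\<And>m. m \<in> {1..M} \<Longrightarrow> zak g (z m) = 0"
  shows "\<not> multi_window_gabor_frame M (\<lambda>m. tf_shift (z m) g) (\<int> \<times> \<int>)
       \<and> \<not> gabor_frame g (\<Union>m\<in>{1..M}. (\<lambda>\<gamma>. \<gamma> + z m) ` (\<int> \<times> \<int>))"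
proof -
  define q where "q N m \<gamma> = (cmod (L2_inner (comb N) (tf_shift \<gamma> (tf_shift (z m) g))))\<^sup>2" for N m \<gamma>
  \<comment> \<open>\<open>M\<close> of these thresholds add up to less than \<open>A\<close>;
    taking M + 1 avoids a zero denominator when M = 0.\<close>
  define Q where "Q A N \<longleftrightarrow>
      (\<forall>m\<in>{1..M}. \<forall>F. finite F \<and> F \<subseteq> \<int> \<times> \<int> \<longrightarrow> sum (q N m) F \<le> A / (2 * real (M + 1)))" for A N
  have QD: "sum (q N m) F \<le> A / (2 * real (M + 1))"
    if "Q A N" "m \<in> {1..M}" "finite F" "F \<subseteq> \<int> \<times> \<int>" for A N m F
    by (rule that(1)[unfolded Q_def, rule_format, OF that(2) conjI[OF that(3,4)]])
  \<comment> \<open>There are finitely many windows, so one \<open>N\<close> serves them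
    all.\<close>
  have small: "\<exists>N>0. Q A N" if A: "A > 0" for A :: real
  proof -
    have "eventually (Q A) sequentially"
      unfolding Q_def
    proof (intro eventually_ball_finite ballI)
      fix m assume "m \<in> {1..M}"
      then show "eventually (\<lambda>N. \<forall>F. finite F \<and> F \<subseteq> \<int> \<times> \<int> \<longrightarrow>
          sum (q N m) F \<le> A / (2 * real (M + 1))) sequentially"
        unfolding q_def using A assms by (intro comb_coefficients_zak_zero) auto
    qed simp
    then have "eventually (\<lambda>N. N > 0 \<and> Q A N) sequentially"
      using eventually_gt_at_top[of 0] by eventually_elim auto
    then show ?thesis
      using eventually_happens'[OF sequentially_bot] by blast
  qed
  \<comment> \<open>\<open>s\<close> stands for the frame sum of either system. As the squared norm
    of the comb is at least 1, the two bounds on \<open>s\<close> would give A < A.\<close>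
  have below: False
    if A: "A > 0" and N: "N > 0" and lower: "ennreal (A * (L2_norm (comb N))\<^sup>2) \<le> s"
      and s: "s \<le> ennreal (\<Sum>m=1..M. A / (2 * real (M + 1)))" for A N s
  proof -
    have "ennreal A \<le> ennreal (A * (L2_norm (comb N))\<^sup>2)"
      using A mult_left_mono[OF comb_norm[OF N], of A] by (intro ennreal_leI) simp
    also have "\<dots> \<le> ennreal (\<Sum>m=1..M. A / (2 * real (M + 1)))"
      using lower s by (rule order_trans)
    also have "(\<Sum>m=1..M. A / (2 * real (M + 1))) < A"
    proof -
      have "real M * A < A * (2 * real (M + 1))" using A by (simp add: algebra_simps add_nonneg_pos)
      then show ?thesis by (simp add: pos_divide_less_eq del: of_nat_add of_nat_Suc)
    qed
    then have "ennreal (\<Sum>m=1..M. A / (2 * real (M + 1))) < ennreal A"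
      using A by (intro ennreal_lessI)
    finally show False by simp
  qed
  show ?thesis
  proof (intro conjI notI)
    assume "multi_window_gabor_frame M (\<lambda>m. tf_shift (z m) g) (\<int> \<times> \<int>)"
    then obtain A where A: "A > 0" and lower: "\<And>f. f \<in> L2_space \<Longrightarrow> ennreal (A * (L2_norm f)\<^sup>2)
        \<le> (\<Sum>m=1..M. \<Sum>\<^sub>\<infinity>\<gamma>\<in>\<int> \<times> \<int>. ennreal ((cmod (L2_inner f (tf_shift \<gamma> (tf_shift (z m) g))))\<^sup>2))"
      unfolding multi_window_gabor_frame_def by metis
    obtain N where N: "N > 0" "Q A N"
      using small[OF A] by blast
    have "(\<Sum>m=1..M. \<Sum>\<^sub>\<infinity>\<gamma>\<in>\<int> \<times> \<int>. ennreal (q N m \<gamma>)) \<le> (\<Sum>m=1..M. ennreal (A / (2 * real (M + 1))))"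
      by (intro sum_mono infsum_ennreal_le QD[OF N(2)]) (auto simp: q_def)
    also have "\<dots> = ennreal (\<Sum>m=1..M. A / (2 * real (M + 1)))"
      using A by (intro sum_ennreal) auto
    finally show False
      using below[OF A N(1) lower[OF comb_L2]] by (simp add: q_def)
  next
    define \<Gamma> where "\<Gamma> m = (\<lambda>\<gamma>. \<gamma> + z m) ` (\<int> \<times> \<int>)" for m
    assume "gabor_frame g (\<Union>m\<in>{1..M}. (\<lambda>\<gamma>. \<gamma> + z m) ` (\<int> \<times> \<int>))"
    then obtain A where A: "A > 0" and lower: "\<And>f. f \<in> L2_space \<Longrightarrow> ennreal (A * (L2_norm f)\<^sup>2)
        \<le> (\<Sum>\<^sub>\<infinity>\<gamma>\<in>(\<Union>m\<in>{1..M}. \<Gamma> m). ennreal ((cmod (L2_inner f (tf_shift \<gamma> g)))\<^sup>2))"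
      unfolding gabor_frame_def \<Gamma>_def by metis
    obtain N where N: "N > 0" "Q A N"
      using small[OF A] by blast
    define p where "p \<gamma> = (cmod (L2_inner (comb N) (tf_shift \<gamma> g)))\<^sup>2" for \<gamma>
    have "(\<Sum>\<^sub>\<infinity>\<gamma>\<in>(\<Union>m\<in>{1..M}. \<Gamma> m). ennreal (p \<gamma>)) \<le> ennreal (\<Sum>m=1..M. A / (2 * real (M + 1)))"
    proof (rule infsum_ennreal_le)
      fix F assume F: "finite F" "F \<subseteq> (\<Union>m\<in>{1..M}. \<Gamma> m)"
      \<comment> \<open>A union bound: each point is charged to every shifted lattice that contains
        it.\<close>
      have "sum p F \<le> (\<Sum>\<gamma>\<in>F. \<Sum>m=1..M. if \<gamma> \<in> \<Gamma> m then p \<gamma> else 0)"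
      proof (rule sum_mono)
        fix \<gamma> assume "\<gamma> \<in> F"
        then obtain m where m: "m \<in> {1..M}" "\<gamma> \<in> \<Gamma> m" using F by auto
        have "(if \<gamma> \<in> \<Gamma> m then p \<gamma> else 0) \<le> (\<Sum>m=1..M. if \<gamma> \<in> \<Gamma> m then p \<gamma> else 0)"
          by (rule member_le_sum[OF m(1)]) (auto simp: p_def)
        then show "p \<gamma> \<le> (\<Sum>m=1..M. if \<gamma> \<in> \<Gamma> m then p \<gamma> else 0)" using m(2) by simp
      qed
      also have "\<dots> = (\<Sum>m=1..M. \<Sum>\<gamma>\<in>F. if \<gamma> \<in> \<Gamma> m then p \<gamma> else 0)"
        by (rule sum.swap)
      also have "\<dots> = (\<Sum>m=1..M. sum p (F \<inter> \<Gamma> m))"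
        using F(1) by (simp add: sum.inter_restrict)
      also have "\<dots> \<le> (\<Sum>m=1..M. A / (2 * real (M + 1)))"
      proof (rule sum_mono)
        fix m assume m: "m \<in> {1..M}"
        \<comment> \<open>The finite piece of the shifted lattice is pulled back to
          \<open>\<int> \<times> \<int>\<close>, where \<open>Q\<close> bounds the coefficients of
          the window \<open>tf_shift (z m) g\<close>.\<close>
        obtain F' where F': "F' \<subseteq> \<int> \<times> \<int>" "finite F'" "F \<inter> \<Gamma> m = (\<lambda>\<gamma>. \<gamma> + z m) ` F'"
          using finite_subset_image[of "F \<inter> \<Gamma> m" "\<lambda>\<gamma>. \<gamma> + z m" "\<int> \<times> \<int>"] F(1)
          unfolding \<Gamma>_def by auto
        have "sum p (F \<inter> \<Gamma> m) = sum (q N m) F'"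
          unfolding F'(3) by (subst sum.reindex) (auto simp: inj_on_def p_def q_def cmod_L2_inner_tf_shift_add)
        also have "\<dots> \<le> A / (2 * real (M + 1))"
          by (rule QD[OF N(2) m F'(2,1)])
        finally show "sum p (F \<inter> \<Gamma> m) \<le> A / (2 * real (M + 1))" .
      qed
      finally show "sum p F \<le> (\<Sum>m=1..M. A / (2 * real (M + 1)))" .
    qed (simp add: p_def)
    then show False
      using below[OF A N(1) lower[OF comb_L2]] by (simp add: p_def)
  qed
qed

end
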